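(* Let $\mathfrak g$ be a finite-dimensional Lie algebra over $\mathbb K=\mathbb R$ or $\mathbb C$ with an ad-invariant metric $g$. Then $\mathfrak g$ is solitary if and only if it is $T^*$-solitary.
   Context: A metric on a Lie algebra $\mathfrak g$ is a nondegenerate symmetric $\mathbb K$-bilinear form $g$; it is ad-invariant if $g([X,Y],Z)=-g(Y,[X,Z])$ for all $X,Y,Z\in\mathfrak g$. A linear map $\phi\colon\mathfrak g\to\mathfrak g$ is ad-invariant if $\phi([X,Y])=[X,\phi(Y)]$ for all $X,Y$. For a linear map $f$, $f^{*_g}$ denotes its adjoint with respect to $g$. An ad-invariant metric $g$ is solitary if every ad-invariant $g$-self-adjoint linear map $\phi\colon\mathfrak g\to\mathfrak g$ can be written as $\phi=D+D^{*_g}$ for some derivation $D$ of $\mathfrak g$. A Lie algebra is solitary if it admits an ad-invariant metric and one (equivalently, every) ad-invariant metric on it is solitary. For a linear map $\phi\colon\mathfrak g\to\mathfrak g^*$: its transpose is ${}^t\phi\colon\mathfrak g\to\mathfrak g^*$, ${}^t\phi(X)(Y)=\phi(Y)(X)$; $\phi$ is symmetric if $\phi={}^t\phi$; $\phi$ is ad-invariant if $\phi([X,Y])(Z)=-\phi(Y)([X,Z])$ for all $X,Y,Z\in\mathfrak g$. A linear map $D\colon\mathfrak g\to\mathfrak g^*$ is a derivation if $D([X,Y])(Z)=D(X)([Y,Z])-D(Y)([X,Z])$ for all $X,Y,Z\in\mathfrak g$. $\mathfrak g$ is $T^*$-solitary if every ad-invariant symmetric linear map $\phi\colon\mathfrak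 g\to\mathfrak g^*$ can be written as $\phi=D+{}^tD$ for some derivation $D\colon\mathfrak g\to\mathfrak g^*$. *)

theory Defs
  imports Complex_Main
begin

locale lie_algebra = vector_space scale
  for scale :: "'k::field \<Rightarrow> 'a::ab_group_add \<Rightarrow> 'a" +
  fixes bracket :: "'a \<Rightarrow> 'a \<Rightarrow> 'a"
  assumes bracket_linear_right: "Vector_Spaces.linear scale scale (\<lambda>Y. bracket X Y)"
    and bracket_linear_left: "Vector_Spaces.linear scale scale (\<lambda>X. bracket X Y)"
    and bracket_self: "bracket X X = 0"
    and jacobi: "bracket X (bracket Y Z) + bracket Y (bracket Z X) + bracket Z (bracket X Y) = 0"
begin

definition ad_invariant_endo :: "('a \<Rightarrow> 'a) \<Rightarrow> bool" where
  "ad_invariant_endo \<phi> \<longleftrightarrow> (\<forall>X Y. \<phi> (bracket X Y) = bracket X (\<phi> Y))"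

definition derivation :: "('a \<Rightarrow> 'a) \<Rightarrow> bool" where
  "derivation D \<longleftrightarrow> Vector_Spaces.linear scale scale D \<and>
     (\<forall>X Y. D (bracket X Y) = bracket (D X) Y + bracket X (D Y))"

definition metric :: "('a \<Rightarrow> 'a \<Rightarrow> 'k) \<Rightarrow> bool" where
  "metric g \<longleftrightarrow>
     (\<forall>X. Vector_Spaces.linear scale (*) (\<lambda>Y. g X Y)) \<and>
     (\<forall>Y. Vector_Spaces.linear scale (*) (\<lambda>X. g X Y)) \<and>
     (\<forall>X Y. g X Y = g Y X) \<and>
     (\<forall>X. (\<forall>Y. g X Y = 0) \<longrightarrow> X = 0)"

definition ad_invariant_metric :: "('a \<Rightarrow> 'a \<Rightarrow> 'k) \<Rightarrow> bool" where
  "ad_invariant_metric g \<longleftrightarrow> metric g \<and>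
     (\<forall>X Y Z. g (bracket X Y) Z = - g Y (bracket X Z))"

text \<open>The adjoint exists and is unique when the space is finite-dimensional, \<open>g\<close> is a metric and
  \<open>f\<close> is linear; see \<open>g_adjoint_works\<close> and \<open>g_adjoint_unique\<close> below.\<close>

definition g_adjoint :: "('a \<Rightarrow> 'a \<Rightarrow> 'k) \<Rightarrow> ('a \<Rightarrow> 'a) \<Rightarrow> 'a \<Rightarrow> 'a" where
  "g_adjoint g f =
     (THE f'. Vector_Spaces.linear scale scale f' \<and> (\<forall>X Y. g (f X) Y = g X (f' Y)))"

definition solitary_metric :: "('a \<Rightarrow> 'a \<Rightarrow> 'k) \<Rightarrow> bool" where
  "solitary_metric g \<longleftrightarrow> ad_invariant_metric g \<and>
     (\<forall>\<phi>. Vector_Spaces.linear scale scale \<phi> \<and> ad_invariant_endo \<phi> \<and> g_adjoint g \<phi> = \<phi> \<longrightarrow>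
        (\<exists>D. derivation D \<and> \<phi> = (\<lambda>X. D X + g_adjoint g D X)))"

definition solitary :: bool where
  "solitary \<longleftrightarrow> (\<exists>g. solitary_metric g)"

text \<open>A linear map from the Lie algebra to its dual is a curried function \<open>\<phi>\<close>: every \<open>\<phi> X\<close> is a
  linear functional, and \<open>\<phi>\<close> itself is linear for the pointwise operations on functionals.\<close>

definition linear_to_dual :: "('a \<Rightarrow> 'a \<Rightarrow> 'k) \<Rightarrow> bool" where
  "linear_to_dual \<phi> \<longleftrightarrow>
     (\<forall>X. Vector_Spaces.linear scale (*) (\<phi> X)) \<and>
     (\<forall>X X'. \<phi> (X + X') = (\<lambda>Y. \<phi> X Y + \<phi> X' Y)) \<and>
     (\<forall>c X. \<phi> (scale c X) = (\<lambda>Y. c * \<phi> X Y))"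

definition dual_transpose :: "('a \<Rightarrow> 'a \<Rightarrow> 'k) \<Rightarrow> 'a \<Rightarrow> 'a \<Rightarrow> 'k" where
  "dual_transpose \<phi> = (\<lambda>X Y. \<phi> Y X)"

definition ad_invariant_to_dual :: "('a \<Rightarrow> 'a \<Rightarrow> 'k) \<Rightarrow> bool" where
  "ad_invariant_to_dual \<phi> \<longleftrightarrow> (\<forall>X Y Z. \<phi> (bracket X Y) Z = - \<phi> Y (bracket X Z))"

definition derivation_to_dual :: "('a \<Rightarrow> 'a \<Rightarrow> 'k) \<Rightarrow> bool" where
  "derivation_to_dual D \<longleftrightarrow> linear_to_dual D \<and>
     (\<forall>X Y Z. D (bracket X Y) Z = D X (bracket Y Z) - D Y (bracket X Z))"

definition Tstar_solitary :: bool where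
  "Tstar_solitary \<longleftrightarrow>
     (\<forall>\<phi>. linear_to_dual \<phi> \<and> ad_invariant_to_dual \<phi> \<and> \<phi> = dual_transpose \<phi> \<longrightarrow>
        (\<exists>D. derivation_to_dual D \<and> \<phi> = (\<lambda>X Y. D X Y + dual_transpose D X Y)))"

end

locale finite_dimensional_lie_algebra = lie_algebra scale bracket
  for scale :: "'k::field \<Rightarrow> 'a::ab_group_add \<Rightarrow> 'a"
    and bracket :: "'a \<Rightarrow> 'a \<Rightarrow> 'a" +
  assumes finite_dimensional: "\<exists>B. finite B \<and> span B = UNIV"
begin

lemma represent_functional:
  assumes g: "metric g" and h: "Vector_Spaces.linear scale (*) h"
  shows "\<exists>Z. \<forall>X. h X = g X Z"
proof -
  obtain B0 where B0: "finite B0" "span B0 = UNIV" using finite_dimensional by blast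
  obtain B where B: "B \<subseteq> B0" "independent B" "span B = UNIV"
    using maximal_independent_subset[of B0] B0(2)
    by (metis span_mono span_span top.extremum_uniqueI)
  have fB: "finite B" using B B0 finite_subset by blast
  interpret fd: finite_dimensional_vector_space scale B
    by unfold_locales (use fB B in auto)
  have gl: "Vector_Spaces.linear scale (*) (g X)"
    and gr: "Vector_Spaces.linear scale (*) (\<lambda>X. g X Y)"
    and gs: "g X Y = g Y X" and gn: "(\<forall>Y. g X Y = 0) \<Longrightarrow> X = 0" for X Y
    using g unfolding metric_def by auto
  interpret m: vector_space_pair scale "(*) :: 'k \<Rightarrow> 'k \<Rightarrow> 'k"
    by unfold_locales (auto simp: algebra_simps)
  interpret p: vector_space_pair scale scale ..
  define L where "L = (\<lambda>Z. \<Sum>b\<in>B. scale (g b Z) b)"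
  have linL: "Vector_Spaces.linear scale scale L"
    unfolding L_def
    by unfold_locales
      (simp_all add: m.linear_add[OF gl] m.linear_scale[OF gl] scale_left_distrib sum.distrib
        scale_sum_right)
  have "Z = 0" if "L Z = 0" for Z
  proof -
    have "g b Z = 0" if "b \<in> B" for b
      using independentD[OF B(2) fB subset_refl, of "\<lambda>b. g b Z"] \<open>L Z = 0\<close> that
      unfolding L_def by auto
    then have "g X Z = 0" for X
      using m.linear_eq_0_on_span[OF gr, of B Z X] B(3) by auto
    then show ?thesis using gn gs by metis
  qed
  then have "inj L"
    using p.linear_inj_iff_eq_0[OF linL] by blast
  then have "surj L"
    using fd.linear_inj_imp_surj[OF linL] by blast
  then obtain Z where Z: "L Z = (\<Sum>b\<in>B. scale (h b) b)" by (metis surjD)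
  have "(\<Sum>b\<in>B. scale (g b Z - h b) b) = 0"
    using Z by (simp add: L_def scale_left_diff_distrib sum_subtractf)
  then have "g b Z = h b" if "b \<in> B" for b
    using independentD[OF B(2) fB subset_refl, of "\<lambda>b. g b Z - h b"] that by auto
  then have "h X = g X Z" for X
    using m.linear_eq_on[OF h gr, of X B Z] B(3) by auto
  then show ?thesis by blast
qed

lemma g_adjoint_unique:
  assumes g: "metric g" and f1: "\<forall>X Y. g (f X) Y = g X (f1 Y)"
    and f2: "\<forall>X Y. g (f X) Y = g X (f2 Y)"
  shows "f1 = f2"
proof
  fix Y
  interpret m: vector_space_pair scale "(*) :: 'k \<Rightarrow> 'k \<Rightarrow> 'k"
    by unfold_locales (auto simp: algebra_simps)
  have "g (f1 Y - f2 Y) X = 0" for X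
  proof -
    have "g (f1 Y - f2 Y) X = g (f1 Y) X - g (f2 Y) X"
      using m.linear_diff[of "\<lambda>W. g W X"] g unfolding metric_def by blast
    also have "\<dots> = g X (f1 Y) - g X (f2 Y)"
      using g unfolding metric_def by metis
    finally show ?thesis using f1 f2 by (metis cancel_comm_monoid_add_class.diff_cancel)
  qed
  then have "f1 Y - f2 Y = 0" using g unfolding metric_def by blast
  then show "f1 Y = f2 Y" by simp
qed

lemma g_adjoint_works:
  assumes g: "metric g" and f: "Vector_Spaces.linear scale scale f"
  shows "Vector_Spaces.linear scale scale (g_adjoint g f)"
    and "g (f X) Y = g X (g_adjoint g f Y)"
proof -
  interpret m: vector_space_pair scale "(*) :: 'k \<Rightarrow> 'k \<Rightarrow> 'k"
    by unfold_locales (auto simp: algebra_simps)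
  have gl: "Vector_Spaces.linear scale (*) (g X)"
    and gr: "Vector_Spaces.linear scale (*) (\<lambda>X. g X Y)"
    and gs: "g X Y = g Y X" and gn: "(\<forall>Y. g X Y = 0) \<Longrightarrow> X = 0" for X Y
    using g unfolding metric_def by auto
  have eqI: "U = V" if "\<And>X. g X U = g X V" for U V
    using gn[of "U - V"] gs that m.linear_diff[OF gl] by (metis eq_iff_diff_eq_0)
  have "Vector_Spaces.linear scale (*) (\<lambda>X. g (f X) Y)" for Y
    using Vector_Spaces.linear_compose[OF f gr] by (simp add: o_def)
  then have "\<forall>Y. \<exists>Z. \<forall>X. g (f X) Y = g X Z"
    using represent_functional[OF g] by blast
  then obtain f' where f': "\<And>X Y. g (f X) Y = g X (f' Y)" by metis
  have "Vector_Spaces.linear scale scale f'"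
  proof unfold_locales
    show "f' (x + y) = f' x + f' y" for x y
      by (rule eqI) (simp add: m.linear_add[OF gl] flip: f')
    show "f' (scale c x) = scale c (f' x)" for c x
      by (rule eqI) (simp add: m.linear_scale[OF gl] flip: f')
  qed
  then have "\<exists>!f'. Vector_Spaces.linear scale scale f' \<and> (\<forall>X Y. g (f X) Y = g X (f' Y))"
    using f' g_adjoint_unique[OF g] by blast
  note adj = theI'[OF this, folded g_adjoint_def]
  show "Vector_Spaces.linear scale scale (g_adjoint g f)" "g (f X) Y = g X (g_adjoint g f Y)"
    using adj by blast+
qed

end

end

theory Submission
  imports Defs
begin

text \<open>An ad-invariant metric \<open>g\<close> identifies the algebra with its dual through \<open>X \<mapsto> g X\<close>. Composing
  with this isomorphism turns endomorphisms into maps to the dual and matches the two notions of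
  ad-invariance, the two notions of derivation, and \<open>g\<close>-adjoints with transposes. Hence for every
  ad-invariant metric the two solitarity conditions are the same.\<close>

context finite_dimensional_lie_algebra
begin

text \<open>The map to the dual obtained by composing \<open>f\<close> with the isomorphism given by
  \<open>g\<close>; in index notation, lowering the index of the value of \<open>f\<close>.\<close>

definition lower :: "('a \<Rightarrow> 'a \<Rightarrow> 'k) \<Rightarrow> ('a \<Rightarrow> 'a) \<Rightarrow> 'a \<Rightarrow> 'a \<Rightarrow> 'k" where
  "lower g f = (\<lambda>X Y. g (f X) Y)"

lemma bracket_swap: "bracket X Y = - bracket Y X"
proof -
  interpret p: vector_space_pair scale scale ..
  have "0 = bracket (X + Y) (X + Y)"
    by (rule bracket_self[symmetric])
  also have "\<dots> = bracket X (X + Y) + bracket Y (X + Y)"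
    by (rule p.linear_add[OF bracket_linear_left])
  also have "\<dots> = bracket X Y + bracket Y X"
    using p.linear_add[OF bracket_linear_right] by (simp add: bracket_self)
  finally show ?thesis
    by (simp add: eq_neg_iff_add_eq_0)
qed

lemma functional_pair: "vector_space_pair scale ((*) :: 'k \<Rightarrow> 'k \<Rightarrow> 'k)"
  by unfold_locales (auto simp: algebra_simps)

lemma metric_commute: "metric g \<Longrightarrow> g X Y = g Y X"
  unfolding metric_def by blast

lemma metric_linear:
  assumes "metric g"
  shows "Vector_Spaces.linear scale (*) (g X)" "Vector_Spaces.linear scale (*) (\<lambda>X. g X Y)"
  using assms unfolding metric_def by blast+

lemma metric_add_left: "metric g \<Longrightarrow> g (X + X') Y = g X Y + g X' Y"
  using vector_space_pair.linear_add[OF functional_pair metric_linear(2)] by blast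

lemma metric_scale_left: "metric g \<Longrightarrow> g (scale c X) Y = c * g X Y"
  using vector_space_pair.linear_scale[OF functional_pair metric_linear(2)] by blast

lemma metric_minus_left: "metric g \<Longrightarrow> g (- X) Y = - g X Y"
  using vector_space_pair.linear_neg[OF functional_pair metric_linear(2)] by blast

text \<open>Nondegeneracy applied to \<open>U - V\<close>. As a rewrite rule it turns equations
  between vectors into equations between scalars, the form in which conditions on maps to the dual
  are stated.\<close>

lemma metric_eq_iff:
  assumes "metric g"
  shows "U = V \<longleftrightarrow> (\<forall>Z. g U Z = g V Z)"
proof
  assume "\<forall>Z. g U Z = g V Z"
  then have "\<forall>Z. g (U - V) Z = 0"
    using vector_space_pair.linear_diff[OF functional_pair metric_linear(2)[OF assms]] by simp
  then have "U - V = 0"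
    using assms unfolding metric_def by blast
  then show "U = V" by simp
qed simp

lemma lower_eq_iff: "metric g \<Longrightarrow> lower g f = lower g f' \<longleftrightarrow> f = f'"
  by (simp add: lower_def fun_eq_iff metric_eq_iff)

lemma lower_add: "metric g \<Longrightarrow> lower g (\<lambda>X. f X + h X) = (\<lambda>X Y. lower g f X Y + lower g h X Y)"
  by (simp add: lower_def metric_add_left)

lemma linear_to_dual_lower_iff:
  assumes g: "metric g"
  shows "linear_to_dual (lower g f) \<longleftrightarrow> Vector_Spaces.linear scale scale f"
proof
  assume *: "linear_to_dual (lower g f)"
  show "Vector_Spaces.linear scale scale f"
  proof unfold_locales
    show "f (X + X') = f X + f X'" for X X'
      using * by (simp add: linear_to_dual_def lower_def metric_eq_iff[OF g] metric_add_left[OF g]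
          fun_eq_iff)
    show "f (scale c X) = scale c (f X)" for c X
      using * by (simp add: linear_to_dual_def lower_def metric_eq_iff[OF g] metric_scale_left[OF g]
          fun_eq_iff)
  qed
next
  interpret p: vector_space_pair scale scale ..
  assume f: "Vector_Spaces.linear scale scale f"
  show "linear_to_dual (lower g f)"
    by (simp add: linear_to_dual_def lower_def p.linear_add[OF f] p.linear_scale[OF f]
        metric_add_left[OF g] metric_scale_left[OF g] metric_linear(1)[OF g] fun_eq_iff)
qed

text \<open>Surjectivity of lowering: each functional \<open>\<phi> X\<close> is represented by a
  vector, which rests on finite dimension, and these vectors are chosen as the values of
  \<open>f\<close>. Linearity of \<open>f\<close> is not claimed here, since
  \<open>linear_to_dual_lower_iff\<close> recovers it.\<close>

lemma linear_to_dual_obtain_lower: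
  assumes g: "metric g" and \<phi>: "linear_to_dual \<phi>"
  obtains f where "\<phi> = lower g f"
proof -
  have "\<exists>Z. \<forall>Y. \<phi> X Y = g Y Z" for X
    using represent_functional[OF g] \<phi> unfolding linear_to_dual_def by blast
  then obtain f where "\<And>X Y. \<phi> X Y = g Y (f X)" by metis
  then show thesis
    using that[of f] metric_commute[OF g] by (auto simp: lower_def)
qed

lemma lower_g_adjoint:
  assumes g: "metric g" and f: "Vector_Spaces.linear scale scale f"
  shows "lower g (g_adjoint g f) = dual_transpose (lower g f)"
  using g_adjoint_works(2)[OF g f] metric_commute[OF g]
  by (simp add: lower_def dual_transpose_def fun_eq_iff)

lemma g_adjoint_eq_self_iff:
  assumes g: "metric g" and f: "Vector_Spaces.linear scale scale f"
  shows "g_adjoint g f = f \<longleftrightarrow> lower g f = dual_transpose (lower g f)"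
  using lower_g_adjoint[OF g f] lower_eq_iff[OF g, of "g_adjoint g f" f] by auto

lemma ad_invariant_metric_bracket_left:
  "ad_invariant_metric g \<Longrightarrow> g (bracket X Y) Z = - g Y (bracket X Z)"
  unfolding ad_invariant_metric_def by blast

text \<open>Antisymmetry of the bracket followed by ad-invariance; the two minus signs
  cancel.\<close>

lemma ad_invariant_metric_bracket_right:
  assumes "ad_invariant_metric g"
  shows "g (bracket X Y) Z = g X (bracket Y Z)"
proof -
  have g: "metric g" using assms by (simp add: ad_invariant_metric_def)
  have "g (bracket X Y) Z = - g (bracket Y X) Z"
    by (subst bracket_swap) (rule metric_minus_left[OF g])
  then show ?thesis
    by (simp add: ad_invariant_metric_bracket_left[OF assms])
qed

lemma ad_invariant_to_dual_lower_iff: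
  assumes "ad_invariant_metric g"
  shows "ad_invariant_to_dual (lower g f) \<longleftrightarrow> ad_invariant_endo f"
proof -
  have g: "metric g" using assms by (simp add: ad_invariant_metric_def)
  show ?thesis
    by (simp add: ad_invariant_to_dual_def ad_invariant_endo_def lower_def metric_eq_iff[OF g]
        ad_invariant_metric_bracket_left[OF assms])
qed

lemma derivation_to_dual_lower_iff:
  assumes "ad_invariant_metric g"
  shows "derivation_to_dual (lower g D) \<longleftrightarrow> derivation D"
proof -
  have g: "metric g" using assms by (simp add: ad_invariant_metric_def)
  \<comment> \<open>The two terms of the Leibniz rule are moved across \<open>g\<close> by different
    rules: in the first, \<open>Y\<close> goes to the right without a sign; in the second,
    \<open>X\<close> goes to the right with a minus sign. The result is the derivation rule for maps
    to the dual.\<close>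
  have "g (bracket (D X) Y + bracket X (D Y)) Z = g (D X) (bracket Y Z) - g (D Y) (bracket X Z)"
    for X Y Z
    by (simp add: metric_add_left[OF g] ad_invariant_metric_bracket_right[OF assms, of "D X"]
        ad_invariant_metric_bracket_left[OF assms, of X])
  then show ?thesis
    unfolding derivation_to_dual_def derivation_def linear_to_dual_lower_iff[OF g]
    by (simp add: lower_def metric_eq_iff[OF g])
qed

lemma derivation_plus_adjoint_iff:
  assumes "ad_invariant_metric g"
  shows "(\<exists>D. derivation D \<and> f = (\<lambda>X. D X + g_adjoint g D X)) \<longleftrightarrow>
    (\<exists>D. derivation_to_dual D \<and> lower g f = (\<lambda>X Y. D X Y + dual_transpose D X Y))"
    (is "?endo \<longleftrightarrow> ?dual")
proof -
  have g: "metric g" using assms by (simp add: ad_invariant_metric_def)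
  \<comment> \<open>Restricted to derivations because \<open>g_adjoint\<close> is a definite
    description, whose properties are available only for linear maps.\<close>
  have eq: "f = (\<lambda>X. D X + g_adjoint g D X) \<longleftrightarrow>
      lower g f = (\<lambda>X Y. lower g D X Y + dual_transpose (lower g D) X Y)" if "derivation D" for D
  proof -
    have "Vector_Spaces.linear scale scale D"
      using that by (simp add: derivation_def)
    then have "lower g (\<lambda>X. D X + g_adjoint g D X) =
        (\<lambda>X Y. lower g D X Y + dual_transpose (lower g D) X Y)"
      by (simp add: lower_add[OF g] lower_g_adjoint[OF g])
    then show ?thesis
      using lower_eq_iff[OF g, of f] by metis
  qed
  show ?thesis
  proof
    assume ?endo
    then show ?dual
      using eq derivation_to_dual_lower_iff[OF assms] by blast
  next
    assume ?dual
    then obtain D where D: "derivation_to_dual D"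
      "lower g f = (\<lambda>X Y. D X Y + dual_transpose D X Y)" by blast
    \<comment> \<open>The witness on the dual side is an arbitrary derivation to the dual, so it
      must first be written as a lowered endomorphism.\<close>
    obtain D' where D': "D = lower g D'"
      using linear_to_dual_obtain_lower[OF g] D(1) unfolding derivation_to_dual_def by blast
    then have "derivation D'"
      using D(1) derivation_to_dual_lower_iff[OF assms] by simp
    then show ?endo
      using eq D(2) D' by blast
  qed
qed

lemma solitary_metric_iff_Tstar_solitary:
  assumes "ad_invariant_metric g"
  shows "solitary_metric g \<longleftrightarrow> Tstar_solitary"
proof -
  have g: "metric g" using assms by (simp add: ad_invariant_metric_def)
  have hyp: "Vector_Spaces.linear scale scale f \<and> ad_invariant_endo f \<and> g_adjoint g f = f \<longleftrightarrow>
      linear_to_dual (lower g f) \<and> ad_invariant_to_dual (lower g f) \<and>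
      lower g f = dual_transpose (lower g f)" for f
    using linear_to_dual_lower_iff[OF g] ad_invariant_to_dual_lower_iff[OF assms]
      g_adjoint_eq_self_iff[OF g] by blast
  have "solitary_metric g \<longleftrightarrow>
      (\<forall>f. linear_to_dual (lower g f) \<and> ad_invariant_to_dual (lower g f) \<and>
        lower g f = dual_transpose (lower g f) \<longrightarrow>
        (\<exists>D. derivation_to_dual D \<and> lower g f = (\<lambda>X Y. D X Y + dual_transpose D X Y)))"
    unfolding solitary_metric_def hyp derivation_plus_adjoint_iff[OF assms] using assms by blast
  \<comment> \<open>The two sides differ only in the range of the quantifier: lowered endomorphisms
    against all linear maps to the dual. Surjectivity of lowering closes the gap.\<close>
  also have "\<dots> \<longleftrightarrow> Tstar_solitary" (is "?lowered \<longleftrightarrow> _")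
  proof
    assume *: ?lowered
    show Tstar_solitary
      unfolding Tstar_solitary_def
    proof (intro allI impI)
      fix \<phi>
      assume \<phi>: "linear_to_dual \<phi> \<and> ad_invariant_to_dual \<phi> \<and> \<phi> = dual_transpose \<phi>"
      obtain f where "\<phi> = lower g f"
        using linear_to_dual_obtain_lower[OF g] \<phi> by blast
      with * \<phi> show "\<exists>D. derivation_to_dual D \<and> \<phi> = (\<lambda>X Y. D X Y + dual_transpose D X Y)"
        by blast
    qed
  next
    assume Tstar_solitary
    then show ?lowered
      unfolding Tstar_solitary_def by blast
  qed
  finally show ?thesis .
qed

text \<open>The metric witnessing \<open>solitary\<close> may differ from \<open>g\<close>. This is
  harmless, since \<open>Tstar_solitary\<close> mentions no metric and the previous equivalence
  holds for each ad-invariant one; \<open>g\<close> itself serves as witness for the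
  converse.\<close>

theorem solitary_iff_Tstar_solitary:
  assumes "ad_invariant_metric g"
  shows "solitary \<longleftrightarrow> Tstar_solitary"
  using assms solitary_metric_iff_Tstar_solitary unfolding solitary_def solitary_metric_def by blast

end

theorem theorem5p8:
  shows "(\<forall>(scale :: real \<Rightarrow> 'a::ab_group_add \<Rightarrow> 'a) bracket g.
            finite_dimensional_lie_algebra scale bracket \<and>
            lie_algebra.ad_invariant_metric scale bracket g \<longrightarrow>
            (lie_algebra.solitary scale bracket \<longleftrightarrow> lie_algebra.Tstar_solitary scale bracket)) \<and>
         (\<forall>(scale :: complex \<Rightarrow> 'b::ab_group_add \<Rightarrow> 'b) bracket g.
            finite_dimensional_lie_algebra scale bracket \<and>
            lie_algebra.ad_invariant_metric scale bracket g \<longrightarrow>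
            (lie_algebra.solitary scale bracket \<longleftrightarrow> lie_algebra.Tstar_solitary scale bracket))"
  by (auto intro!: finite_dimensional_lie_algebra.solitary_iff_Tstar_solitary)

end
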